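(* Let $\alpha,\beta>0$ and $\lambda\in\mathbb{R}$. The partial derivative $\frac{\partial}{\partial\alpha}\left(t^{\beta-1}E_{\alpha,\beta}(\lambda t^{\alpha})\right)$ is a convoluted form with kernel of logarithmic type: $$\frac{\partial}{\partial\alpha}\left(t^{\beta-1}E_{\alpha,\beta}(\lambda t^{\alpha})\right)=\lambda\int_0^t\left(\ln(t-t_1)+\gamma_0\right)t_1^{\alpha+\beta-2}\,E^{2}_{\alpha,\alpha+\beta-1}(\lambda t_1^{\alpha})\,dt_1$$ for every $t\ge0$.
   Context: $E_{\alpha,\beta}(z)=\sum_{k=0}^{\infty}\frac{z^k}{\Gamma(\alpha k+\beta)}$ is the two-parametric Mittag-Leffler function. $E_{\alpha,\beta}^{\gamma}(z)=\sum_{k=0}^{\infty}\frac{(\gamma)_k\,z^k}{k!\,\Gamma(\alpha k+\beta)}$ is the Prabhakar function, where $(\gamma)_k=\gamma(\gamma+1)\cdots(\gamma+k-1)$, $(\gamma)_0=1$ and $1/\Gamma$ is taken to be $0$ at the poles of $\Gamma$; the superscript $2$ means $\gamma=2$ (not a square). $\gamma_0$ is the Euler–Mascheroni constant.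
   Formalization: The formal theorem assumes in addition α+β>1; for α+β<1 the integral diverges at 0, and for α+β=1 the two sides differ by λ(ln t+γ₀). At t=0 the power t^(β−1) is read as 0. *)

theory Defs
  imports "HOL-Analysis.Analysis"
begin

(* The entire function rGamma is 1/Gamma, continued by 0 to the poles of Gamma. *)

definition mittag_leffler :: "'a::Gamma \<Rightarrow> 'a \<Rightarrow> 'a \<Rightarrow> 'a" where
  "mittag_leffler a b z = (\<Sum>k. z ^ k * rGamma (a * of_nat k + b))"

definition prabhakar :: "'a::Gamma \<Rightarrow> 'a \<Rightarrow> 'a \<Rightarrow> 'a \<Rightarrow> 'a" where
  "prabhakar g a b z = (\<Sum>k. pochhammer g k * z ^ k / fact k * rGamma (a * of_nat k + b))"

end

theory Submission
  imports Defs
begin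

text \<open>
  Write \<open>F t x = t powr (x - 1) / Gamma x\<close> for the kernel of Riemann--Liouville fractional
  integration of order \<open>x\<close> and \<open>F' t x\<close> for its derivative in \<open>x\<close>. Both sides of the identity
  are power series in \<open>l\<close> whose coefficients are values of \<open>F'\<close>.

  On the left, \<open>t powr (\<beta> - 1) * E\<close> is the sum of \<open>l ^ k * F t (\<alpha> k + \<beta>)\<close>, so the derivative in
  \<open>\<alpha>\<close> is the sum of \<open>k * l ^ k * F' t (\<alpha> k + \<beta>)\<close>. On the right, the coefficient
  \<open>pochhammer 2 j / fact j\<close> is \<open>j + 1\<close>, and everything reduces to one integral:
  convolving \<open>ln + \<gamma>\<close> with \<open>F _ p\<close> gives \<open>F' t (p + 1)\<close>
  (\<open>has_bochner_integral_log_kernel\<close>), because the power series of \<open>ln (1 - s / t)\<close>, integrated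
  term by term, is the partial fraction series of the Digamma function. With
  \<open>p = \<alpha> j + \<alpha> + \<beta> - 1\<close> the argument \<open>p + 1\<close> is \<open>\<alpha> (j + 1) + \<beta>\<close>; the substitution
  \<open>k = j + 1\<close> matches the two series and accounts for the factor \<open>l\<close> in front of the integral.

  The interchanges of the sum with the derivative and with the integral rest on one estimate:
  as \<open>x\<close> grows, \<open>F t x\<close> and \<open>F' t x\<close> decay faster than every exponential, with a bound valid on
  all of \<open>x > 0\<close> (\<open>superexp_decay\<close>). This gives a convergent majorant that is uniform in all
  parameters \<open>a \<ge> a0 > 0\<close>.
\<close>

section \<open>Growth of the Gamma function\<close>

text \<open>
  Discard the part of Euler's integral below \<open>N\<close>, and replace \<open>s powr (x - 1)\<close> by its least value
  \<open>N powr (x - 1)\<close> on the rest. As \<open>N\<close> is free, \<open>Gamma\<close> outgrows every exponential.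
\<close>
lemma powr_le_Gamma:
  fixes x N :: real
  assumes "x \<ge> 1" "N > 0"
  shows "N powr (x - 1) * exp (- N) \<le> Gamma x"
proof -
  have "((\<lambda>s. N powr (x - 1) * exp (-1 * s)) has_integral N powr (x - 1) * (exp (-1 * N) / 1)) {N..}"
    by (intro has_integral_mult_right has_integral_exp_minus_to_infinity) simp
  then have I: "((\<lambda>s. N powr (x - 1) * exp (- s)) has_integral N powr (x - 1) * exp (- N)) {N..}"
    by simp
  have G: "((\<lambda>s. s powr (x - 1) / exp s) has_integral Gamma x) {0..}"
    using assms by (intro Gamma_integral_real) simp
  have "((\<lambda>s. if s \<in> {N..} then N powr (x - 1) * exp (- s) else 0) has_integral
          N powr (x - 1) * exp (- N)) {0..}"
    using I assms by (subst has_integral_restrict) auto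
  then show ?thesis
    by (rule has_integral_le[OF _ G])
      (use assms in \<open>auto simp: exp_minus field_simps intro!: powr_mono2\<close>)
qed

text \<open>
  Digamma is increasing, so it suffices to look at the two integers \<open>1\<close> and \<open>\<lceil>x\<rceil> + 1\<close>, where it is
  a harmonic number minus \<open>\<gamma>\<close>. A linear bound is far from sharp but is harmless against the decay
  of \<open>rGamma\<close>.
\<close>
lemma abs_Digamma_plus1_le:
  fixes x :: real
  assumes "x \<ge> 0"
  shows "\<bar>Digamma (x + 1)\<bar> \<le> x + 1"
proof -
  define n where "n = nat \<lceil>x\<rceil>"
  have n: "x \<le> real n" "real n \<le> x + 1"
    using assms unfolding n_def by linarith+
  have gamma: "0 < (euler_mascheroni :: real)" "(euler_mascheroni :: real) < 1"
    using euler_mascheroni_pos euler_mascheroni_less_13_over_22 by auto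
  have "harm n \<le> (\<Sum>k=1..n. 1 :: real)"
    unfolding harm_def by (intro sum_mono) (auto simp: field_simps)
  then have "Digamma (real (Suc n)) \<le> real n"
    using gamma by (subst Digamma_of_nat) simp
  moreover have "Digamma (x + 1) \<le> Digamma (real (Suc n))"
    using assms n by (intro Digamma_real_mono) auto
  moreover have "Digamma 1 \<le> Digamma (x + 1)"
    using assms by (intro Digamma_real_mono) auto
  ultimately show ?thesis
    using n gamma assms by (simp add: abs_le_iff)
qed

text \<open>
  The bound is required on the whole half-line \<open>x > 0\<close>, not only eventually; then no
  initial terms of a series have to be treated separately.
\<close>
definition superexp_decay :: "(real \<Rightarrow> real) \<Rightarrow> bool" where
  "superexp_decay f \<longleftrightarrow> (\<forall>N>0. \<exists>C. \<forall>x>0. \<bar>f x\<bar> \<le> C * N powr (- x))"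

text \<open>
  The recurrences at \<open>x + 1\<close> make the bounds valid down to \<open>x = 0\<close>: they turn both functions into
  \<open>rGamma (x + 1)\<close> times a factor of size at most \<open>(1 + x)\<^sup>2\<close>, and so cancel the pole of Digamma
  at \<open>0\<close>.
\<close>
lemma
  shows superexp_decay_rGamma: "superexp_decay rGamma"
    and superexp_decay_Digamma_rGamma: "superexp_decay (\<lambda>x. Digamma x * rGamma x)"
proof -
  have *: "\<bar>rGamma x\<bar> \<le> exp (N * exp 2) * N powr (- x) \<and>
           \<bar>Digamma x * rGamma x\<bar> \<le> exp (N * exp 2) * N powr (- x)"
    if N: "N > 0" and x: "x > 0" for N x :: real
  proof -
    \<comment> \<open>The extra factor \<open>exp 2\<close> in the base pays for \<open>(1 + x)\<^sup>2 \<le> exp (2 * x)\<close>.\<close>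
    define L where "L = N * exp 2"
    have "L > 0"
      using N by (simp add: L_def)
    have pos: "rGamma (x + 1) > 0"
      using x by (simp add: rGamma_inverse_Gamma)
    have "L powr x * exp (- L) \<le> Gamma (x + 1)"
      using powr_le_Gamma[of "x + 1" L] \<open>L > 0\<close> x by simp
    then have "rGamma (x + 1) \<le> inverse (L powr x * exp (- L))"
      unfolding rGamma_inverse_Gamma using \<open>L > 0\<close> by (intro le_imp_inverse_le) auto
    also have "\<dots> = exp L * N powr (- x) * exp (- (2 * x))"
      using N unfolding L_def
      by (simp add: powr_mult powr_minus exp_minus exp_powr_real field_simps)
    finally have R: "rGamma (x + 1) \<le> exp L * N powr (- x) * exp (- (2 * x))" .
    have "(1 + x)\<^sup>2 \<le> (exp x)\<^sup>2"
      using x exp_ge_add_one_self[of x] by (intro power_mono) auto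
    then have "(1 + x)\<^sup>2 \<le> exp (2 * x)"
      by (simp add: exp_double)
    then have "(1 + x)\<^sup>2 * rGamma (x + 1) \<le>
               exp (2 * x) * (exp L * N powr (- x) * exp (- (2 * x)))"
      using pos R by (intro mult_mono) auto
    then have B: "(1 + x)\<^sup>2 * rGamma (x + 1) \<le> exp L * N powr (- x)"
      by (simp add: exp_minus field_simps)
    have r: "rGamma x = x * rGamma (x + 1)"
      using rGamma_plus1[of x] by simp
    have "x * rGamma (x + 1) \<le> (1 + x)\<^sup>2 * rGamma (x + 1)"
      using x pos by (intro mult_right_mono) (auto simp: power2_eq_square algebra_simps)
    then have 1: "\<bar>rGamma x\<bar> \<le> exp L * N powr (- x)"
      using order_trans[OF _ B] x pos unfolding r by simp
    have "Digamma x * rGamma x = (x * Digamma (x + 1) - 1) * rGamma (x + 1)"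
      using x unfolding r by (subst Digamma_plus1) (auto simp: field_simps)
    moreover have "\<bar>x * Digamma (x + 1) - 1\<bar> \<le> (1 + x)\<^sup>2"
    proof -
      have "\<bar>x * Digamma (x + 1)\<bar> \<le> x * (x + 1)"
        using abs_Digamma_plus1_le[of x] x by (simp add: abs_mult)
      then show ?thesis
        using x unfolding power2_eq_square by (simp add: abs_le_iff algebra_simps)
    qed
    ultimately have "\<bar>Digamma x * rGamma x\<bar> \<le> (1 + x)\<^sup>2 * rGamma (x + 1)"
      using pos by (simp add: abs_mult mult_right_mono)
    with B 1 show ?thesis
      unfolding L_def by simp
  qed
  show "superexp_decay rGamma" "superexp_decay (\<lambda>x. Digamma x * rGamma x)"
    unfolding superexp_decay_def using * by blast+
qed

text \<open>
  The Weierstrass majorant for every series below. The weight \<open>Suc k\<close> covers the factors that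
  come from differentiation in \<open>a\<close> and from the Pochhammer symbol; monotonicity of the
  exponential bound makes one majorant serve all \<open>a \<ge> a0\<close>.
\<close>
lemma superexp_decay_imp_summable_majorant:
  fixes a0 b c :: real
  assumes f: "superexp_decay f" and a0: "a0 > 0" and b: "b > 0"
  obtains M where "summable M"
    and "\<And>a k. a \<ge> a0 \<Longrightarrow> real (Suc k) * \<bar>c\<bar> ^ k * \<bar>f (a * real k + b)\<bar> \<le> M k"
proof -
  \<comment> \<open>The base \<open>N\<close> is chosen so that \<open>N powr (- (a0 * k))\<close> absorbs \<open>\<bar>c\<bar> ^ k\<close> and \<open>Suc k \<le> 2 ^ k\<close>
     and still leaves a geometric factor \<open>(1 / 2) ^ k\<close>.\<close>
  define D where "D = 4 * (\<bar>c\<bar> + 1)"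
  define N where "N = D powr (1 / a0)"
  have D: "D \<ge> 4"
    by (simp add: D_def)
  have "N \<ge> 1"
    unfolding N_def using D a0 by (intro ge_one_powr_ge_zero) auto
  then obtain C where C: "\<And>x. x > 0 \<Longrightarrow> \<bar>f x\<bar> \<le> C * N powr (- x)"
    using f unfolding superexp_decay_def by (metis less_le_trans zero_less_one)
  have "0 \<le> \<bar>f 1\<bar>"
    by simp
  also have "\<dots> \<le> C * N powr (- 1)"
    by (rule C) simp
  finally have "C \<ge> 0"
    using \<open>N \<ge> 1\<close> by (simp add: zero_le_mult_iff powr_minus zero_le_divide_iff)
  show ?thesis
  proof
    show "summable (\<lambda>k. C * (1 / 2) ^ k)"
      by (intro summable_mult summable_geometric) simp
    fix a :: real and k :: nat
    assume a: "a \<ge> a0"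
    have "a0 * real k \<le> a * real k + b"
      using a b by (smt (verit) mult_right_mono of_nat_0_le_iff)
    moreover have "a * real k + b > 0"
      using a a0 b by (intro add_nonneg_pos) auto
    ultimately have "\<bar>f (a * real k + b)\<bar> \<le> C * N powr (- (a0 * real k))"
      using C[of "a * real k + b"] \<open>C \<ge> 0\<close> \<open>N \<ge> 1\<close>
      by (smt (verit) mult_left_mono powr_mono)
    also have "N powr (- (a0 * real k)) = (1 / D) ^ k"
      unfolding N_def using a0 D
      by (simp add: powr_powr powr_minus powr_realpow inverse_eq_divide power_one_over)
    moreover have Suc: "real (Suc k) \<le> 2 ^ k"
      using Suc_leI[OF less_exp[of k]] by (metis of_nat_le_iff of_nat_numeral of_nat_power)
    ultimately have "real (Suc k) * \<bar>c\<bar> ^ k * \<bar>f (a * real k + b)\<bar> \<le> (2 ^ k * \<bar>c\<bar> ^ k) * (C * (1 / D) ^ k)"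
      using Suc by (intro mult_mono) auto
    also have "\<dots> = C * (2 * \<bar>c\<bar> / D) ^ k"
      by (simp add: power_divide power_mult_distrib)
    also have "\<dots> \<le> C * (1 / 2) ^ k"
      using \<open>C \<ge> 0\<close> D by (intro mult_left_mono power_mono) (auto simp: D_def field_simps)
    finally show "real (Suc k) * \<bar>c\<bar> ^ k * \<bar>f (a * real k + b)\<bar> \<le> C * (1 / 2) ^ k" .
  qed
qed

section \<open>Differentiation in the first parameter\<close>

text \<open>The kernel of Riemann--Liouville fractional integration of order \<open>x\<close>.\<close>
definition rl_kernel :: "real \<Rightarrow> real \<Rightarrow> real" where
  "rl_kernel t x = t powr (x - 1) * rGamma x"

definition rl_kernel_deriv :: "real \<Rightarrow> real \<Rightarrow> real" where
  "rl_kernel_deriv t x = t powr (x - 1) * (ln t - Digamma x) * rGamma x"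

lemma has_real_derivative_rl_kernel:
  assumes "t > 0" "x > 0"
  shows "(rl_kernel t has_real_derivative rl_kernel_deriv t x) (at x)"
proof -
  have "x \<notin> \<int>\<^sub>\<le>\<^sub>0"
    using assms by (auto elim!: nonpos_Ints_cases)
  then have "((\<lambda>x. t powr (x - 1) * rGamma x) has_real_derivative rl_kernel_deriv t x) (at x)"
    using assms unfolding rl_kernel_deriv_def
    by (auto intro!: derivative_eq_intros simp: algebra_simps)
  then show ?thesis
    by (simp add: rl_kernel_def[abs_def])
qed

text \<open>
  For fixed \<open>t\<close> the power \<open>t powr (x - 1)\<close> is itself exponential in \<open>x\<close>, so it only changes the
  base: the decay of the Gamma factors with base \<open>N * t\<close> gives decay with base \<open>N\<close>.
\<close>
lemma
  assumes t: "t > 0"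
  shows superexp_decay_rl_kernel: "superexp_decay (rl_kernel t)"
    and superexp_decay_rl_kernel_deriv: "superexp_decay (rl_kernel_deriv t)"
proof -
  have powr_eq: "t powr (x - 1) * (N * t) powr (- x) = N powr (- x) / t" if "N > 0" for N x :: real
    using t that by (simp add: powr_mult powr_diff powr_minus field_simps)
  have "\<exists>C. \<forall>x>0. \<bar>rl_kernel t x\<bar> \<le> C * N powr (- x) \<and> \<bar>rl_kernel_deriv t x\<bar> \<le> C * N powr (- x)"
    if N: "N > 0" for N :: real
  proof -
    have "N * t > 0"
      using N t by simp
    then obtain A B where A: "\<And>x. x > 0 \<Longrightarrow> \<bar>rGamma x\<bar> \<le> A * (N * t) powr (- x)"
      and B: "\<And>x. x > 0 \<Longrightarrow> \<bar>Digamma x * rGamma x\<bar> \<le> B * (N * t) powr (- x)"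
      using superexp_decay_rGamma superexp_decay_Digamma_rGamma
      unfolding superexp_decay_def by meson
    have K: "\<bar>rl_kernel t x\<bar> \<le> A / t * N powr (- x)" if "x > 0" for x
    proof -
      have "\<bar>rl_kernel t x\<bar> \<le> t powr (x - 1) * (A * (N * t) powr (- x))"
        unfolding rl_kernel_def abs_mult using A[OF that] by (intro mult_mono) auto
      also have "\<dots> = A / t * N powr (- x)"
        using powr_eq[OF N, of x] by (metis mult.left_commute times_divide_eq_left times_divide_eq_right)
      finally show ?thesis .
    qed
    have D: "\<bar>rl_kernel_deriv t x\<bar> \<le> (\<bar>ln t\<bar> * A + B) / t * N powr (- x)" if "x > 0" for x
    proof -
      have "\<bar>(ln t - Digamma x) * rGamma x\<bar> \<le> \<bar>ln t\<bar> * \<bar>rGamma x\<bar> + \<bar>Digamma x * rGamma x\<bar>"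
        unfolding left_diff_distrib by (metis abs_mult abs_triangle_ineq4)
      also have "\<dots> \<le> \<bar>ln t\<bar> * (A * (N * t) powr (- x)) + B * (N * t) powr (- x)"
        using A[OF that] B[OF that] by (intro add_mono mult_left_mono) auto
      finally have "\<bar>rl_kernel_deriv t x\<bar> \<le>
          t powr (x - 1) * (\<bar>ln t\<bar> * (A * (N * t) powr (- x)) + B * (N * t) powr (- x))"
        unfolding rl_kernel_deriv_def mult.assoc abs_mult[of "t powr (x - 1)"]
        by (intro mult_mono) auto
      also have "\<dots> = (\<bar>ln t\<bar> * A + B) * (t powr (x - 1) * (N * t) powr (- x))"
        by (simp add: algebra_simps)
      also have "\<dots> = (\<bar>ln t\<bar> * A + B) / t * N powr (- x)"
        unfolding powr_eq[OF N] by simp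
      finally show ?thesis .
    qed
    define C where "C = max (A / t) ((\<bar>ln t\<bar> * A + B) / t)"
    have "A / t * N powr (- x) \<le> C * N powr (- x)"
      "(\<bar>ln t\<bar> * A + B) / t * N powr (- x) \<le> C * N powr (- x)" for x
      unfolding C_def by (intro mult_right_mono; simp)+
    then have "\<forall>x>0. \<bar>rl_kernel t x\<bar> \<le> C * N powr (- x) \<and> \<bar>rl_kernel_deriv t x\<bar> \<le> C * N powr (- x)"
      using K D by (meson order_trans)
    then show ?thesis ..
  qed
  then show "superexp_decay (rl_kernel t)" "superexp_decay (rl_kernel_deriv t)"
    unfolding superexp_decay_def by meson+
qed

text \<open>
  The factor \<open>t powr (\<beta> - 1)\<close> and the argument \<open>l * t powr a\<close> combine into the kernel at
  \<open>a * k + \<beta>\<close>. Staying above \<open>\<alpha> / 2\<close> keeps \<open>a\<close> away from \<open>0\<close>, where the series may lose its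
  uniform convergence.
\<close>
lemma has_real_derivative_mittag_leffler_first_parameter:
  fixes \<alpha> \<beta> l t :: real
  assumes \<alpha>: "\<alpha> > 0" and \<beta>: "\<beta> > 0" and t: "t > 0"
  shows "((\<lambda>a. t powr (\<beta> - 1) * mittag_leffler a \<beta> (l * t powr a)) has_real_derivative
           (\<Sum>k. l ^ k * (real k * rl_kernel_deriv t (\<alpha> * real k + \<beta>)))) (at \<alpha>)"
    and "summable (\<lambda>k. l ^ k * (real k * rl_kernel_deriv t (\<alpha> * real k + \<beta>)))"
proof -
  define S where "S = {\<alpha> / 2<..}"
  have pos: "a * real k + \<beta> > 0" if "a \<in> S" for a k
    using that \<alpha> \<beta> by (intro add_nonneg_pos) (auto simp: S_def)
  have \<alpha>S: "\<alpha> \<in> S"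
    using \<alpha> by (simp add: S_def)
  obtain M where M: "summable M"
    "\<And>a k. a \<ge> \<alpha> / 2 \<Longrightarrow> real (Suc k) * \<bar>l\<bar> ^ k * \<bar>rl_kernel t (a * real k + \<beta>)\<bar> \<le> M k"
    using superexp_decay_imp_summable_majorant[OF superexp_decay_rl_kernel[OF t], of "\<alpha> / 2" \<beta> l]
      \<alpha> \<beta> by auto
  obtain M' where M': "summable M'"
    "\<And>a k. a \<ge> \<alpha> / 2 \<Longrightarrow> real (Suc k) * \<bar>l\<bar> ^ k * \<bar>rl_kernel_deriv t (a * real k + \<beta>)\<bar> \<le> M' k"
    using superexp_decay_imp_summable_majorant[OF superexp_decay_rl_kernel_deriv[OF t], of "\<alpha> / 2" \<beta> l]
      \<alpha> \<beta> by auto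
  have bound: "norm (l ^ k * rl_kernel t (a * real k + \<beta>)) \<le> M k" if "a \<in> S" for a k
  proof -
    have "1 * (\<bar>l\<bar> ^ k * \<bar>rl_kernel t (a * real k + \<beta>)\<bar>)
        \<le> real (Suc k) * (\<bar>l\<bar> ^ k * \<bar>rl_kernel t (a * real k + \<beta>)\<bar>)"
      by (intro mult_right_mono) auto
    then show ?thesis
      using M(2)[of a k] that by (simp add: S_def abs_mult power_abs mult.assoc)
  qed
  have bound': "norm (l ^ k * (real k * rl_kernel_deriv t (a * real k + \<beta>))) \<le> M' k" if "a \<in> S" for a k
  proof -
    have "real k * (\<bar>l\<bar> ^ k * \<bar>rl_kernel_deriv t (a * real k + \<beta>)\<bar>)
        \<le> real (Suc k) * (\<bar>l\<bar> ^ k * \<bar>rl_kernel_deriv t (a * real k + \<beta>)\<bar>)"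
      by (intro mult_right_mono) auto
    then show ?thesis
      using M'(2)[of a k] that by (simp add: S_def abs_mult power_abs mult_ac)
  qed
  have summ: "summable (\<lambda>k. l ^ k * rl_kernel t (a * real k + \<beta>))" if "a \<in> S" for a
    by (rule summable_comparison_test'[OF M(1), of 0]) (rule bound[OF that])
  have series: "t powr (\<beta> - 1) * mittag_leffler a \<beta> (l * t powr a) =
      (\<Sum>k. l ^ k * rl_kernel t (a * real k + \<beta>))" if "a \<in> S" for a
  proof -
    have eq: "l ^ k * rl_kernel t (a * real k + \<beta>) =
        t powr (\<beta> - 1) * ((l * t powr a) ^ k * rGamma (a * real k + \<beta>))" for k
    proof -
      have "t powr (a * real k + \<beta> - 1) = t powr (\<beta> - 1) * (t powr a) ^ k"
        using t by (simp add: powr_powr powr_add[symmetric] algebra_simps flip: powr_realpow)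
      then show ?thesis
        by (simp add: rl_kernel_def power_mult_distrib)
    qed
    have "summable (\<lambda>k. (l * t powr a) ^ k * rGamma (a * real k + \<beta>))"
      using summ[OF that] t unfolding eq by (subst (asm) summable_cmult_iff) auto
    then show ?thesis
      unfolding mittag_leffler_def eq by (rule suminf_mult[symmetric])
  qed
  have deriv: "((\<lambda>a. l ^ k * rl_kernel t (a * real k + \<beta>)) has_real_derivative
      l ^ k * (real k * rl_kernel_deriv t (a * real k + \<beta>))) (at a within S)" if "a \<in> S" for a k
  proof -
    have "((\<lambda>a. a * real k + \<beta>) has_real_derivative real k) (at a within S)"
      by (auto intro!: derivative_eq_intros)
    then have "((\<lambda>a. rl_kernel t (a * real k + \<beta>)) has_real_derivative
        rl_kernel_deriv t (a * real k + \<beta>) * real k) (at a within S)"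
      by (rule DERIV_chain2[where g = "\<lambda>a. a * real k + \<beta>",
            OF has_real_derivative_rl_kernel[OF t pos[OF that, of k]]])
    then show ?thesis
      unfolding mult.commute[of "real k"] by (rule DERIV_cmult)
  qed
  have unif: "uniformly_convergent_on S (\<lambda>n a. \<Sum>k<n. l ^ k * (real k * rl_kernel_deriv t (a * real k + \<beta>)))"
    by (rule Weierstrass_m_test'[OF bound' M'(1)])
  have "((\<lambda>a. \<Sum>k. l ^ k * rl_kernel t (a * real k + \<beta>)) has_real_derivative
      (\<Sum>k. l ^ k * (real k * rl_kernel_deriv t (\<alpha> * real k + \<beta>)))) (at \<alpha>)"
    using has_field_derivative_series'(2)[OF _ deriv unif \<alpha>S summ[OF \<alpha>S]] \<alpha>S
    by (simp add: S_def interior_open)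
  then show "((\<lambda>a. t powr (\<beta> - 1) * mittag_leffler a \<beta> (l * t powr a)) has_real_derivative
           (\<Sum>k. l ^ k * (real k * rl_kernel_deriv t (\<alpha> * real k + \<beta>)))) (at \<alpha>)"
    by (rule has_field_derivative_transform_within_open[where S = S])
      (use \<alpha>S series in \<open>auto simp: S_def\<close>)
  show "summable (\<lambda>k. l ^ k * (real k * rl_kernel_deriv t (\<alpha> * real k + \<beta>)))"
    by (rule summable_comparison_test'[OF M'(1), of 0]) (rule bound'[OF \<alpha>S])
qed

section \<open>The logarithmic kernel\<close>

lemma has_bochner_integral_powr:
  fixes p t :: real
  assumes "p > 0" "t \<ge> 0"
  shows "has_bochner_integral lborel (\<lambda>s. indicator {0..t} s * s powr (p - 1)) (t powr p / p)"
proof (rule has_bochner_integral_nn_integral)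
  have "((\<lambda>s. s powr (p - 1)) has_integral t powr p / p) {0..t}"
    using has_integral_powr_from_0[of "p - 1" t] assms by simp
  then show "(\<integral>\<^sup>+ s. ennreal (indicator {0..t} s * s powr (p - 1)) \<partial>lborel) = ennreal (t powr p / p)"
    by (intro nn_integral_has_integral_lebesgue) auto
qed (use assms in auto)

text \<open>
  The partial fraction series of Digamma in the form in which it arises from integrating the
  logarithm series against \<open>s powr (p - 1)\<close>.
\<close>
lemma sums_Digamma_plus1:
  fixes p :: real
  assumes "p > 0"
  shows "(\<lambda>k. 1 / ((real k + 1) * (real k + 1 + p))) sums ((Digamma (p + 1) + euler_mascheroni) / p)"
proof -
  have "(\<lambda>k. inverse (real (Suc k)) - inverse (p + 1 + real k)) sums
      (Digamma (p + 1) + euler_mascheroni)"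
    using summable_Digamma[of "p + 1"] assms unfolding Digamma_def by (simp add: summable_sums)
  then have "(\<lambda>k. (inverse (real (Suc k)) - inverse (p + 1 + real k)) / p) sums
      ((Digamma (p + 1) + euler_mascheroni) / p)"
    by (rule sums_divide)
  moreover have "(inverse (real (Suc k)) - inverse (p + 1 + real k)) / p =
      1 / ((real k + 1) * (real k + 1 + p))" for k
  proof -
    have "p + 1 + real k \<noteq> 0" "real k + 1 \<noteq> 0" "p \<noteq> 0"
      using assms by linarith+
    then show ?thesis
      by (simp add: divide_simps) (simp add: algebra_simps)
  qed
  ultimately show ?thesis
    by simp
qed

text \<open>
  All terms of the series of \<open>- ln (1 - s / t)\<close> are nonnegative, so convergence of the sum of the
  integrals is the only condition for integrating term by term.
\<close>
lemma has_bochner_integral_ln_one_minus_powr: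
  fixes p t :: real
  assumes p: "p > 0" and t: "t > 0"
  shows "has_bochner_integral lborel (\<lambda>s. indicator {0..t} s * (- ln (1 - s / t) * s powr (p - 1)))
           (t powr p / p * (Digamma (p + 1) + euler_mascheroni))"
proof -
  \<comment> \<open>The exponent is left as \<open>q - 1\<close> with \<open>q = p + k + 1\<close>, to match \<open>has_bochner_integral_powr\<close>.\<close>
  define f where "f k s = indicator {0..t} s * s powr (p + real k + 1 - 1) * (1 / (t ^ Suc k * real (Suc k)))"
    for k s
  have f_int: "has_bochner_integral lborel (f k) (t powr p * (1 / ((real k + 1) * (real k + 1 + p))))" for k
  proof -
    have "has_bochner_integral lborel (f k)
        (t powr (p + real k + 1) / (p + real k + 1) * (1 / (t ^ Suc k * real (Suc k))))"
      unfolding f_def using p t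
      by (intro has_bochner_integral_mult_left has_bochner_integral_powr) auto
    moreover have "t powr (p + real k + 1) = t powr p * t ^ Suc k"
      using t by (simp add: powr_add powr_realpow)
    ultimately show ?thesis
      using t by (simp add: add_ac mult_ac)
  qed
  have f_sums: "(\<lambda>k. f k s) sums (indicator {0..t} s * (- ln (1 - s / t) * s powr (p - 1)))"
    if "s \<noteq> t" for s
  proof (cases "s \<in> {0<..<t}")
    case True
    then have "(\<lambda>n. - ((- (- s / t)) ^ n) / real n) sums ln (1 + (- s / t))"
      by (intro ln_series') (auto simp: abs_if)
    then have "(\<lambda>n. (s / t) ^ n / real n) sums (- ln (1 - s / t))"
      using sums_minus by fastforce
    then have "(\<lambda>k. (s / t) ^ Suc k / real (Suc k)) sums (- ln (1 - s / t))"
      by (subst sums_Suc_iff) simp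
    then have "(\<lambda>k. (s / t) ^ Suc k / real (Suc k) * s powr (p - 1)) sums (- ln (1 - s / t) * s powr (p - 1))"
      by (rule sums_mult2)
    moreover have "(s / t) ^ Suc k / real (Suc k) * s powr (p - 1) = f k s" for k
    proof -
      have "s powr (p + real k + 1 - 1) = s powr ((p - 1) + real (Suc k))"
        by (simp add: algebra_simps)
      also have "\<dots> = s powr (p - 1) * s ^ Suc k"
        using True by (subst powr_add) (auto simp: powr_realpow simp del: power_Suc of_nat_Suc)
      finally show ?thesis
        using True by (simp add: f_def power_divide)
    qed
    ultimately show ?thesis
      using True by simp
  next
    case False
    then have "s \<notin> {0..t} \<or> s = 0"
      using that by auto
    then show ?thesis
      by (auto simp: f_def)
  qed
  \<comment> \<open>At \<open>s = t\<close> the series diverges while \<open>ln 0\<close> has the value \<open>0\<close>; this single point is null.\<close>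
  have AE_t: "AE s in lborel. s \<noteq> t"
    by (rule AE_lborel_singleton)
  have f_nonneg: "norm (f k s) = f k s" for k s
    using t by (auto simp: f_def indicator_def)
  note S = sums_mult[OF sums_Digamma_plus1[OF p], of "t powr p"]
  have integrable: "integrable lborel (f k)" and int_eq:
    "integral\<^sup>L lborel (f k) = t powr p * (1 / ((real k + 1) * (real k + 1 + p)))" for k
    using f_int[of k] by (simp_all add: has_bochner_integral_iff)
  have summ1: "AE s in lborel. summable (\<lambda>k. norm (f k s))"
    using AE_t unfolding f_nonneg by eventually_elim (rule sums_summable[OF f_sums])
  have summ2: "summable (\<lambda>k. \<integral>s. norm (f k s) \<partial>lborel)"
    using S unfolding f_nonneg int_eq by (rule sums_summable)
  have "has_bochner_integral lborel (\<lambda>s. \<Sum>k. f k s) (t powr p * ((Digamma (p + 1) + euler_mascheroni) / p))"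
    unfolding has_bochner_integral_iff
    using integrable_suminf[OF integrable summ1 summ2] integral_suminf[OF integrable summ1 summ2] S
    by (simp add: int_eq sums_iff)
  then have "has_bochner_integral lborel (\<lambda>s. indicator {0..t} s * (- ln (1 - s / t) * s powr (p - 1)))
      (t powr p * ((Digamma (p + 1) + euler_mascheroni) / p))"
    by (rule has_bochner_integral_discrete_difference[where X = "{t}", THEN iffD1, rotated 4])
      (use f_sums in \<open>auto simp: sums_iff\<close>)
  then show ?thesis
    by simp
qed

text \<open>
  Convolution with \<open>ln + \<gamma>\<close> acts on the Riemann--Liouville kernel as integration followed by
  differentiation in the order. Splitting \<open>ln (t - s)\<close> as \<open>ln t + ln (1 - s / t)\<close> leaves
  \<open>ln t + \<gamma> - (Digamma (p + 1) + \<gamma>)\<close>: the constant \<open>\<gamma>\<close> in the kernel is there to cancel the one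
  that Digamma brings in.
\<close>
lemma has_bochner_integral_log_kernel:
  fixes p t :: real
  assumes p: "p > 0" and t: "t > 0"
  shows "has_bochner_integral lborel
           (\<lambda>s. indicator {0..t} s * ((ln (t - s) + euler_mascheroni) * s powr (p - 1)) * rGamma p)
           (rl_kernel_deriv t (p + 1))"
proof -
  let ?\<gamma> = "euler_mascheroni :: real"
  have "has_bochner_integral lborel
      (\<lambda>s. (ln t + ?\<gamma>) * (indicator {0..t} s * s powr (p - 1))
         - indicator {0..t} s * (- ln (1 - s / t) * s powr (p - 1)))
      ((ln t + ?\<gamma>) * (t powr p / p) - t powr p / p * (Digamma (p + 1) + ?\<gamma>))"
    using p t by (intro has_bochner_integral_diff has_bochner_integral_mult_right
        has_bochner_integral_powr has_bochner_integral_ln_one_minus_powr) auto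
  then have "has_bochner_integral lborel
      (\<lambda>s. indicator {0..t} s * ((ln (t - s) + ?\<gamma>) * s powr (p - 1)))
      ((ln t + ?\<gamma>) * (t powr p / p) - t powr p / p * (Digamma (p + 1) + ?\<gamma>))"
  proof (rule has_bochner_integral_discrete_difference[where X = "{t}", THEN iffD1, rotated 4])
    fix s :: real
    assume "s \<notin> {t}"
    show "(ln t + ?\<gamma>) * (indicator {0..t} s * s powr (p - 1))
         - indicator {0..t} s * (- ln (1 - s / t) * s powr (p - 1)) =
         indicator {0..t} s * ((ln (t - s) + ?\<gamma>) * s powr (p - 1))"
    proof (cases "s \<in> {0..t}")
      case True
      then have "s < t"
        using \<open>s \<notin> {t}\<close> by auto
      have "ln (t - s) = ln (t * (1 - s / t))"
        using t by (simp add: algebra_simps)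
      also have "\<dots> = ln t + ln (1 - s / t)"
        using t \<open>s < t\<close> by (intro ln_mult_pos) auto
      finally show ?thesis
        using True by (simp add: algebra_simps)
    qed simp
  qed auto
  then have "has_bochner_integral lborel
      (\<lambda>s. indicator {0..t} s * ((ln (t - s) + ?\<gamma>) * s powr (p - 1)) * rGamma p)
      (((ln t + ?\<gamma>) * (t powr p / p) - t powr p / p * (Digamma (p + 1) + ?\<gamma>)) * rGamma p)"
    by (rule has_bochner_integral_mult_left)
  moreover have "((ln t + ?\<gamma>) * (t powr p / p) - t powr p / p * (Digamma (p + 1) + ?\<gamma>)) * rGamma p =
      rl_kernel_deriv t (p + 1)"
    using p unfolding rl_kernel_deriv_def rGamma_plus1[of p, symmetric] by (simp add: field_simps)
  ultimately show ?thesis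
    by simp
qed

section \<open>The Prabhakar function in the integrand\<close>

lemma pochhammer_2_div_fact: "pochhammer 2 k / fact k = real (Suc k)"
proof -
  have "pochhammer 2 k = (fact (Suc k) :: real)"
    using pochhammer_rec[of "1 :: real" k] by (simp only: pochhammer_fact[symmetric] mult_1 one_add_one)
  then show ?thesis
    by simp
qed

text \<open>
  On \<open>{0..t}\<close> the powers \<open>(s powr a) ^ k\<close> are at most \<open>(t powr a) ^ k\<close>, so the series is dominated
  by the integrable leading factor \<open>h\<close> times a convergent numerical series, and may be integrated
  term by term.
\<close>
lemma has_bochner_integral_log_prabhakar:
  fixes a p l t :: real
  assumes a: "a > 0" and p: "p > 0" and t: "t > 0"
  shows "has_bochner_integral lborel
           (\<lambda>s. indicator {0..t} s * ((ln (t - s) + euler_mascheroni) * s powr (p - 1)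
                  * prabhakar 2 a p (l * s powr a)))
           (\<Sum>k. real (Suc k) * l ^ k * rl_kernel_deriv t (a * real k + p + 1))"
proof -
  define h where "h s = indicator {0..t} s * ((ln (t - s) + euler_mascheroni) * s powr (p - 1))" for s
  define g where "g k s = h s * (real (Suc k) * (l * s powr a) ^ k * rGamma (a * real k + p))" for k s
  have pos: "a * real k + p > 0" for k
    using a p by (intro add_nonneg_pos) auto
  have g_int: "has_bochner_integral lborel (g k) (real (Suc k) * l ^ k * rl_kernel_deriv t (a * real k + p + 1))"
    for k
  proof -
    have "g k s = real (Suc k) * l ^ k *
        (indicator {0..t} s * ((ln (t - s) + euler_mascheroni) * s powr (a * real k + p - 1)) *
          rGamma (a * real k + p))" for s
    proof (cases "s > 0")
      case True
      then have "s powr (a * real k + p - 1) = s powr (p - 1) * (s powr a) ^ k"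
        by (simp add: powr_powr powr_add[symmetric] algebra_simps flip: powr_realpow)
      then show ?thesis
        by (simp add: g_def h_def power_mult_distrib)
    next
      case False
      then have "s \<notin> {0..t} \<or> s = 0"
        by auto
      then show ?thesis
        by (auto simp: g_def h_def)
    qed
    then show ?thesis
      using has_bochner_integral_mult_right[OF has_bochner_integral_log_kernel[OF pos t], of "real (Suc k) * l ^ k" k]
      by presburger
  qed
  \<comment> \<open>Up to the nonzero constant \<open>rGamma p\<close>, \<open>h\<close> is the term \<open>k = 0\<close>.\<close>
  have h_int: "integrable lborel h"
  proof -
    have "rGamma p \<noteq> 0"
      using p by (auto simp: rGamma_eq_zero_iff elim!: nonpos_Ints_cases)
    moreover have "g 0 = (\<lambda>s. h s * rGamma p)"
      by (simp add: g_def fun_eq_iff)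
    ultimately show ?thesis
      using g_int[of 0] by (simp add: has_bochner_integral_iff)
  qed
  obtain M where M: "summable M"
    "\<And>k. real (Suc k) * \<bar>l * t powr a\<bar> ^ k * \<bar>rGamma (a * real k + p)\<bar> \<le> M k"
    using superexp_decay_imp_summable_majorant[OF superexp_decay_rGamma a p] by (metis order_refl)
  have g_bound: "norm (g k s) \<le> norm (h s) * M k" for k s
  proof (cases "s \<in> {0..t}")
    case True
    then have "s powr a \<le> t powr a"
      using a by (intro powr_mono2) auto
    then have "\<bar>l * s powr a\<bar> ^ k \<le> \<bar>l * t powr a\<bar> ^ k"
      by (intro power_mono) (auto simp: abs_mult intro: mult_left_mono)
    then have "real (Suc k) * \<bar>l * s powr a\<bar> ^ k * \<bar>rGamma (a * real k + p)\<bar>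
        \<le> real (Suc k) * \<bar>l * t powr a\<bar> ^ k * \<bar>rGamma (a * real k + p)\<bar>"
      by (intro mult_right_mono mult_left_mono) auto
    then have "\<bar>real (Suc k) * (l * s powr a) ^ k * rGamma (a * real k + p)\<bar> \<le> M k"
      using M(2)[of k] by (simp only: abs_mult power_abs abs_of_nat)
    then show ?thesis
      unfolding g_def norm_mult[of "h s"] by (intro mult_left_mono) auto
  qed (simp add: g_def h_def)
  have integrable: "integrable lborel (g k)" and int_eq:
    "integral\<^sup>L lborel (g k) = real (Suc k) * l ^ k * rl_kernel_deriv t (a * real k + p + 1)" for k
    using g_int[of k] by (simp_all add: has_bochner_integral_iff)
  have g_summable: "summable (\<lambda>k. norm (g k s))" for s
    by (rule summable_comparison_test'[OF summable_mult[OF M(1)], of 0 _ "norm (h s)"])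
      (use g_bound in simp)
  then have summ1: "AE s in lborel. summable (\<lambda>k. norm (g k s))"
    by simp
  have summ2: "summable (\<lambda>k. \<integral>s. norm (g k s) \<partial>lborel)"
  proof (rule summable_comparison_test'[of "\<lambda>k. (\<integral>s. norm (h s) \<partial>lborel) * M k" 0])
    fix k :: nat
    have "(\<integral>s. norm (g k s) \<partial>lborel) \<le> (\<integral>s. norm (h s) * M k \<partial>lborel)"
      using integrable h_int g_bound by (intro integral_mono) auto
    then show "norm (\<integral>s. norm (g k s) \<partial>lborel) \<le> (\<integral>s. norm (h s) \<partial>lborel) * M k"
      by simp
  qed (use M(1) in auto)
  have "has_bochner_integral lborel (\<lambda>s. \<Sum>k. g k s)
      (\<Sum>k. real (Suc k) * l ^ k * rl_kernel_deriv t (a * real k + p + 1))"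
    unfolding has_bochner_integral_iff
    using integrable_suminf[OF integrable summ1 summ2] integral_suminf[OF integrable summ1 summ2]
    by (simp only: int_eq)
  moreover have "(\<Sum>k. g k s) = indicator {0..t} s * ((ln (t - s) + euler_mascheroni) * s powr (p - 1)
      * prabhakar 2 a p (l * s powr a))" for s
  proof (cases "h s = 0")
    case True
    then show ?thesis
      by (auto simp: g_def h_def)
  next
    case False
    have "summable (\<lambda>k. g k s)"
      using g_summable by (rule summable_norm_cancel)
    then have "summable (\<lambda>k. real (Suc k) * (l * s powr a) ^ k * rGamma (a * real k + p))"
      unfolding g_def using False by (subst (asm) summable_cmult_iff) auto
    then have "(\<Sum>k. g k s) = h s * (\<Sum>k. real (Suc k) * (l * s powr a) ^ k * rGamma (a * real k + p))"
      unfolding g_def by (rule suminf_mult)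
    also have "(\<lambda>k. real (Suc k) * (l * s powr a) ^ k * rGamma (a * real k + p)) =
        (\<lambda>k. pochhammer 2 k * (l * s powr a) ^ k / fact k * rGamma (a * real k + p))"
      unfolding pochhammer_2_div_fact[symmetric] by simp
    finally show ?thesis
      by (simp add: h_def prabhakar_def)
  qed
  ultimately show ?thesis
    by simp
qed

section \<open>The derivative as a convolution\<close>

theorem theorem11:
  fixes \<alpha> \<beta> l t :: real
  assumes "\<alpha> > 0" and "\<beta> > 0" and "\<alpha> + \<beta> > 1" and "t \<ge> 0"
  shows "set_integrable lborel {0..t}
           (\<lambda>s. (ln (t - s) + euler_mascheroni) * s powr (\<alpha> + \<beta> - 2)
                * prabhakar 2 \<alpha> (\<alpha> + \<beta> - 1) (l * s powr \<alpha>)) \<and>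
         ((\<lambda>a. t powr (\<beta> - 1) * mittag_leffler a \<beta> (l * t powr a)) has_real_derivative
           l * (LBINT s:{0..t}. (ln (t - s) + euler_mascheroni) * s powr (\<alpha> + \<beta> - 2)
                * prabhakar 2 \<alpha> (\<alpha> + \<beta> - 1) (l * s powr \<alpha>))) (at \<alpha>)"
proof (cases "t = 0")
  case True
  \<comment> \<open>Here \<open>0 powr _ = 0\<close> makes the differentiated function and the integrand vanish identically.\<close>
  then have "(\<lambda>s. indicator {0..t} s *\<^sub>R ((ln (t - s) + euler_mascheroni) * s powr (\<alpha> + \<beta> - 2)
                * prabhakar 2 \<alpha> (\<alpha> + \<beta> - 1) (l * s powr \<alpha>))) = (\<lambda>_. 0)"
    by (auto simp: indicator_def)
  then show ?thesis
    unfolding set_integrable_def set_lebesgue_integral_def using True by simp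
next
  case False
  then have t: "t > 0"
    using assms by simp
  let ?p = "\<alpha> + \<beta> - 1"
  let ?I = "\<Sum>k. real (Suc k) * l ^ k * rl_kernel_deriv t (\<alpha> * real k + ?p + 1)"
  let ?f = "\<lambda>s. (ln (t - s) + euler_mascheroni) * s powr (\<alpha> + \<beta> - 2)
                * prabhakar 2 \<alpha> (\<alpha> + \<beta> - 1) (l * s powr \<alpha>)"
  let ?d = "\<lambda>k. l ^ k * (real k * rl_kernel_deriv t (\<alpha> * real k + \<beta>))"
  have "has_bochner_integral lborel (\<lambda>s. indicator {0..t} s *\<^sub>R ?f s) ?I"
    using has_bochner_integral_log_prabhakar[of \<alpha> ?p t l] assms t by (simp add: diff_diff_eq)
  then have int: "set_integrable lborel {0..t} ?f" "(LBINT s:{0..t}. ?f s) = ?I"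
    unfolding set_integrable_def set_lebesgue_integral_def has_bochner_integral_iff by auto
  \<comment> \<open>The term \<open>k = 0\<close> of the derivative vanishes, so the series starts at \<open>k = 1\<close>.\<close>
  have shift: "?d (Suc k) = l * (real (Suc k) * l ^ k * rl_kernel_deriv t (\<alpha> * real k + ?p + 1))" for k
    by (simp add: algebra_simps)
  note summ = has_real_derivative_mittag_leffler_first_parameter(2)[OF assms(1,2) t, of l]
  have "(\<Sum>k. ?d k) = (\<Sum>k. ?d (Suc k))"
    using suminf_split_head[OF summ] by simp
  also have "\<dots> = l * ?I"
  proof (cases "l = 0")
    case False
    have "summable (\<lambda>k. ?d (Suc k))"
      using summ by (subst summable_Suc_iff)
    then have "summable (\<lambda>k. real (Suc k) * l ^ k * rl_kernel_deriv t (\<alpha> * real k + ?p + 1))"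
      unfolding shift using False by (subst (asm) summable_cmult_iff) auto
    then show ?thesis
      unfolding shift by (rule suminf_mult)
  qed simp
  finally show ?thesis
    using has_real_derivative_mittag_leffler_first_parameter(1)[OF assms(1,2) t, of l] int by simp
qed

end
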